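(* Let $H$ be a set of random variables or (finite-dimensional) random vectors, not necessarily of the same dimension, on a probability space $(\Omega,\mathcal F,\mathbb P)$. Then the following statements are equivalent: (i) $H$ is uniformly integrable, i.e. $$\sup_{X\in H}\int_{\{|X|>s\}}|X|\,d\mathbb P\to0\quad\text{as } s\to\infty.$$ (ii) There exists a nondecreasing function $\psi\colon[0,\infty)\to[0,\infty)$ with $\psi(0)=0$, $\frac{\psi(s)}{s}\to\infty$ as $s\to\infty$ and $$\sup_{X\in H}\int_\Omega\psi(|X|)\,d\mathbb P<\infty.$$ The function $\psi$ in (ii) can be chosen to be continuously differentiable, strictly convex and in such a way that $\{\psi(|X|) : X\in H\}$ is again uniformly integrable.
   Context: $|X|$ denotes the absolute value, respectively the Euclidean norm, of $X$. *)

theory Defs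
  imports "HOL-Probability.Probability"
begin

text \<open>
  A random vector carries its own dimension, so that one set may contain vectors of different
  dimensions: the pair \<open>(n, X)\<close> stands for an \<open>\<real>\<^sup>n\<close>-valued random vector with components
  \<open>X \<omega> 0, \<dots>, X \<omega> (n - 1)\<close>, where \<open>\<real>\<^sup>n\<close> is the product space \<open>\<Pi>\<^sub>M i\<in>{..<n}. borel\<close>.
  A real random variable is a vector of dimension 1.
\<close>

type_synonym 'a rvec = "nat \<times> ('a \<Rightarrow> nat \<Rightarrow> real)"

definition random_vector :: "'a measure \<Rightarrow> 'a rvec \<Rightarrow> bool" where
  "random_vector M V \<longleftrightarrow> snd V \<in> M \<rightarrow>\<^sub>M (\<Pi>\<^sub>M i\<in>{..<fst V}. borel)"

definition vabs :: "'a rvec \<Rightarrow> 'a \<Rightarrow> real" where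
  "vabs V \<omega> = L2_set (snd V \<omega>) {..<fst V}"

definition of_rv :: "('a \<Rightarrow> real) \<Rightarrow> 'a rvec" where
  "of_rv Y = (1, \<lambda>\<omega>. \<lambda>i\<in>{..<1}. Y \<omega>)"

lemma random_vector_of_rv: "Y \<in> borel_measurable M \<Longrightarrow> random_vector M (of_rv Y)"
  by (simp add: random_vector_def of_rv_def)

lemma vabs_of_rv: "vabs (of_rv Y) \<omega> = \<bar>Y \<omega>\<bar>"
  by (simp add: vabs_def of_rv_def L2_set_def)

lemma vabs_measurable: "random_vector M V \<Longrightarrow> vabs V \<in> borel_measurable M"
proof -
  assume "random_vector M V"
  then have [measurable]: "snd V \<in> M \<rightarrow>\<^sub>M (\<Pi>\<^sub>M i\<in>{..<fst V}. borel)"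
    by (simp add: random_vector_def)
  show ?thesis
    unfolding vabs_def[abs_def] L2_set_def by measurable
qed

text \<open>
  Integrals of nonnegative functions, and their suprema, are taken in \<open>[0,\<infinity>]\<close>; in particular the
  supremum over an empty set is 0.
\<close>

definition unif_integrable :: "'a measure \<Rightarrow> 'a rvec set \<Rightarrow> bool" where
  "unif_integrable M H \<longleftrightarrow>
     ((\<lambda>s::real. \<Squnion>V\<in>H. \<integral>\<^sup>+\<omega>\<in>{\<omega> \<in> space M. vabs V \<omega> > s}. ennreal (vabs V \<omega>) \<partial>M)
        \<longlongrightarrow> 0) at_top"

text \<open>
  A function \<open>[0,\<infinity>) \<rightarrow> \<real>\<close> is represented by a function on all reals of which only the values on
  \<open>{0..}\<close> are ever constrained or used.
\<close>

definition vallee_poussin :: "'a measure \<Rightarrow> 'a rvec set \<Rightarrow> (real \<Rightarrow> real) \<Rightarrow> bool" where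
  "vallee_poussin M H \<psi> \<longleftrightarrow>
     mono_on {0..} \<psi> \<and> (\<forall>s\<ge>0. \<psi> s \<ge> 0) \<and> \<psi> 0 = 0 \<and>
     filterlim (\<lambda>s. \<psi> s / s) at_top at_top \<and>
     (\<Squnion>V\<in>H. \<integral>\<^sup>+\<omega>. ennreal (\<psi> (vabs V \<omega>)) \<partial>M) < \<infinity>"

text \<open>
  The derivative at 0 is one-sided; the library's \<open>C1_differentiable_on\<close> would constrain \<open>f\<close> on
  negative arguments.
\<close>

definition cont_diff_nonneg :: "(real \<Rightarrow> real) \<Rightarrow> bool" where
  "cont_diff_nonneg f \<longleftrightarrow>
     (\<exists>f'. (\<forall>s\<ge>0. (f has_real_derivative f' s) (at s within {0..})) \<and> continuous_on {0..} f')"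

definition strictly_convex_on :: "real set \<Rightarrow> (real \<Rightarrow> real) \<Rightarrow> bool" where
  "strictly_convex_on S f \<longleftrightarrow> convex S \<and>
     (\<forall>x\<in>S. \<forall>y\<in>S. \<forall>t. x \<noteq> y \<longrightarrow> 0 < t \<longrightarrow> t < 1 \<longrightarrow>
        f ((1 - t) * x + t * y) < (1 - t) * f x + t * f y)"

end

theory Submission
  imports Defs
begin

text \<open>
  If \<open>H\<close> is uniformly integrable, choose \<open>a\<^sub>0 = 0\<close> and \<open>a\<^sub>n \<ge> n\<close> such that the tail integrals of \<open>H\<close> at
  level \<open>a\<^sub>n\<close> are at most \<open>2\<^sup>-\<^sup>n\<close> for \<open>n \<ge> 1\<close>, and set \<open>\<psi> x = (\<Sum>n. h (x - a\<^sub>n))\<close>, where \<open>h\<close> is a \<open>C\<^sup>1\<close> convex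
  smoothing of the positive part with \<open>u - 1 \<le> h u \<le> max 0 u\<close>. The sum is locally finite, it is
  superlinear because every summand grows linearly, and integrating termwise over \<open>{\<bar>X\<bar> > t}\<close> bounds
  the integral of \<open>\<psi> \<bar>X\<bar>\<close> by the sum of the tails at the levels \<open>max a\<^sub>n t\<close>. For \<open>t < 0\<close> this is the
  moment bound, and for \<open>t \<rightarrow> \<infinity>\<close> it yields uniform integrability of \<open>\<psi> \<bar>X\<bar>\<close>.
\<close>

section \<open>Uniform integrability in terms of tail integrals\<close>

definition tail :: "'a measure \<Rightarrow> 'a rvec set \<Rightarrow> real \<Rightarrow> ennreal" where
  "tail M H s = (\<Squnion>V\<in>H. \<integral>\<^sup>+\<omega>\<in>{\<omega> \<in> space M. vabs V \<omega> > s}. ennreal (vabs V \<omega>) \<partial>M)"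

lemma vabs_nonneg [simp]: "0 \<le> vabs V \<omega>"
  by (simp add: vabs_def)

lemma tail_upper:
  "V \<in> H \<Longrightarrow> (\<integral>\<^sup>+\<omega>\<in>{\<omega> \<in> space M. vabs V \<omega> > s}. ennreal (vabs V \<omega>) \<partial>M) \<le> tail M H s"
  unfolding tail_def by (rule SUP_upper)

lemma tail_antimono: "s \<le> t \<Longrightarrow> tail M H t \<le> tail M H s"
  unfolding tail_def
  by (intro SUP_mono' nn_integral_mono) (auto simp: indicator_def)

lemma tendsto_0_ennreal_at_top_iff:
  fixes f :: "real \<Rightarrow> ennreal"
  shows "(f \<longlongrightarrow> 0) at_top \<longleftrightarrow> (\<forall>e>0. \<exists>s0. \<forall>s\<ge>s0. f s \<le> ennreal e)"
proof
  assume f: "(f \<longlongrightarrow> 0) at_top"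
  show "\<forall>e>0. \<exists>s0. \<forall>s\<ge>s0. f s \<le> ennreal e"
  proof (intro allI impI)
    fix e :: real assume "e > 0"
    with f have "eventually (\<lambda>s. f s < ennreal e) at_top"
      by (intro order_tendstoD) auto
    then show "\<exists>s0. \<forall>s\<ge>s0. f s \<le> ennreal e"
      by (auto simp: eventually_at_top_linorder intro: less_imp_le)
  qed
next
  assume *: "\<forall>e>0. \<exists>s0. \<forall>s\<ge>s0. f s \<le> ennreal e"
  show "(f \<longlongrightarrow> 0) at_top"
  proof (rule order_tendstoI)
    fix e :: ennreal assume "0 < e"
    \<comment> \<open>Since \<open>e\<close> may be infinite, a positive real strictly below it is
      used; this also turns the weak bound into a strict one.\<close>
    then obtain r where r: "0 < r" "r < e" using dense by blast
    then obtain q where q: "r = ennreal q" "q \<ge> 0" by (cases r) auto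
    with r have "q > 0" by auto
    with * obtain s0 where "\<forall>s\<ge>s0. f s \<le> ennreal q" by blast
    with r q show "eventually (\<lambda>s. f s < e) at_top"
      by (auto simp: eventually_at_top_linorder intro: le_less_trans)
  qed auto
qed

lemma unif_integrable_iff_tail:
  "unif_integrable M H \<longleftrightarrow> (\<forall>e>0. \<exists>s0. \<forall>s\<ge>s0. tail M H s \<le> ennreal e)"
  unfolding unif_integrable_def tail_def[symmetric] by (rule tendsto_0_ennreal_at_top_iff)

text \<open>Where \<open>vabs V\<close> is at most \<open>s\<close> it contributes at most
  \<open>s\<close> on a space of mass 1; the remainder is the tail at level \<open>s\<close>. This
  controls the summand with level 0, which cannot be made small by choice.\<close>

lemma unif_integrable_tail_0_finite:
  assumes "prob_space M" and V: "\<forall>V\<in>H. random_vector M V" and "unif_integrable M H"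
  shows "tail M H 0 < \<infinity>"
proof -
  interpret prob_space M by fact
  from assms(3) obtain s0 where s0: "\<forall>s\<ge>s0. tail M H s \<le> ennreal 1"
    unfolding unif_integrable_iff_tail using zero_less_one by blast
  define s where "s = max 0 s0"
  have "tail M H 0 \<le> ennreal s + tail M H s"
    unfolding tail_def[of M H 0]
  proof (rule SUP_least)
    fix V assume "V \<in> H"
    with V have [measurable]: "vabs V \<in> borel_measurable M" using vabs_measurable by blast
    have "(\<integral>\<^sup>+\<omega>\<in>{\<omega> \<in> space M. vabs V \<omega> > 0}. ennreal (vabs V \<omega>) \<partial>M)
        \<le> (\<integral>\<^sup>+\<omega>. ennreal s + ennreal (vabs V \<omega>) * indicator {\<omega> \<in> space M. vabs V \<omega> > s} \<omega> \<partial>M)"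
      by (intro nn_integral_mono) (auto simp: indicator_def s_def intro!: ennreal_leI)
    also have "\<dots> = ennreal s + (\<integral>\<^sup>+\<omega>\<in>{\<omega> \<in> space M. vabs V \<omega> > s}. ennreal (vabs V \<omega>) \<partial>M)"
      by (subst nn_integral_add) (auto simp: emeasure_space_1)
    also have "\<dots> \<le> ennreal s + tail M H s"
      using \<open>V \<in> H\<close> by (intro add_left_mono tail_upper)
    finally show "(\<integral>\<^sup>+\<omega>\<in>{\<omega> \<in> space M. vabs V \<omega> > 0}. ennreal (vabs V \<omega>) \<partial>M)
        \<le> ennreal s + tail M H s" .
  qed
  also have "\<dots> \<le> ennreal s + ennreal 1" using s0 by (intro add_left_mono) (auto simp: s_def)
  also have "\<dots> < \<infinity>" by simp
  finally show ?thesis .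
qed

section \<open>From a superlinear moment bound to uniform integrability\<close>

text \<open>A Markov-type estimate: at high levels superlinearity gives
  \<open>K * vabs V \<omega> \<le> \<psi> (vabs V \<omega>)\<close>, so each tail is at most the
  moment bound divided by \<open>K\<close>.\<close>

lemma vallee_poussin_imp_unif_integrable:
  assumes V: "\<forall>V\<in>H. random_vector M V" and \<psi>: "vallee_poussin M H \<psi>"
  shows "unif_integrable M H"
  unfolding unif_integrable_iff_tail
proof (intro allI impI)
  fix e :: real assume "e > 0"
  define C where "C = (\<Squnion>V\<in>H. \<integral>\<^sup>+\<omega>. ennreal (\<psi> (vabs V \<omega>)) \<partial>M)"
  have "C < \<infinity>" using \<psi> by (simp add: vallee_poussin_def C_def)
  then obtain c where c: "C = ennreal c" "c \<ge> 0" by (cases C) auto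
  \<comment> \<open>The summand 1 keeps \<open>K\<close> positive even for \<open>c = 0\<close>, so
    that it can be cancelled at the end.\<close>
  define K where "K = c / e + 1"
  have "K > 0" using c \<open>e > 0\<close> by (auto simp: K_def add_nonneg_pos)
  have ce: "c \<le> K * e" using \<open>e > 0\<close> by (simp add: K_def field_simps)
  have "eventually (\<lambda>s. \<psi> s / s \<ge> K) at_top"
    using \<psi> by (simp add: vallee_poussin_def filterlim_at_top)
  then obtain s1 where s1: "\<And>s. s \<ge> s1 \<Longrightarrow> \<psi> s / s \<ge> K"
    by (auto simp: eventually_at_top_linorder)
  show "\<exists>s0. \<forall>s\<ge>s0. tail M H s \<le> ennreal e"
  \<comment> \<open>The 1 guarantees \<open>vabs V \<omega> > 0\<close> beyond the level, so the
    quotient can be cleared.\<close>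
  proof (intro exI[of _ "max 1 s1"] allI impI)
    fix s assume s: "s \<ge> max 1 s1"
    show "tail M H s \<le> ennreal e"
      unfolding tail_def
    proof (rule SUP_least)
      fix V assume "V \<in> H"
      with V have [measurable]: "vabs V \<in> borel_measurable M" using vabs_measurable by blast
      define I where "I = (\<integral>\<^sup>+\<omega>\<in>{\<omega> \<in> space M. vabs V \<omega> > s}. ennreal (vabs V \<omega>) \<partial>M)"
      have "ennreal K * I
          = (\<integral>\<^sup>+\<omega>. ennreal K * (ennreal (vabs V \<omega>) * indicator {\<omega> \<in> space M. vabs V \<omega> > s} \<omega>) \<partial>M)"
        unfolding I_def by (rule nn_integral_cmult[symmetric]) measurable
      also have "\<dots> \<le> (\<integral>\<^sup>+\<omega>. ennreal (\<psi> (vabs V \<omega>)) \<partial>M)"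
      proof (rule nn_integral_mono)
        fix \<omega>
        show "ennreal K * (ennreal (vabs V \<omega>) * indicator {\<omega> \<in> space M. vabs V \<omega> > s} \<omega>)
            \<le> ennreal (\<psi> (vabs V \<omega>))"
        proof (cases "vabs V \<omega> > s")
          case True
          with s have "K \<le> \<psi> (vabs V \<omega>) / vabs V \<omega>" "vabs V \<omega> > 0" using s1 by auto
          then have "K * vabs V \<omega> \<le> \<psi> (vabs V \<omega>)" by (simp add: field_simps)
          then show ?thesis using \<open>K > 0\<close>
            by (auto simp: indicator_def ennreal_mult[symmetric] intro!: ennreal_leI)
        qed (simp add: indicator_def)
      qed
      also have "\<dots> \<le> C" unfolding C_def using \<open>V \<in> H\<close> by (rule SUP_upper)
      also have "\<dots> \<le> ennreal K * ennreal e"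
        using ce c \<open>K > 0\<close> \<open>e > 0\<close> by (simp add: ennreal_mult[symmetric] ennreal_leI)
      finally have "ennreal K * I \<le> ennreal K * ennreal e" .
      then show "I \<le> ennreal e"
        using \<open>K > 0\<close> by (simp add: ennreal_mult_le_mult_iff)
    qed
  qed
qed

section \<open>A continuously differentiable convex smoothing of the positive part\<close>

text \<open>For \<open>u \<ge> 0\<close> this equals \<open>u - 1 + 1 / (1 + u)\<close>, from which
  the linear bounds and the strictly increasing derivative can be read off.\<close>

definition smooth_pos :: "real \<Rightarrow> real" where
  "smooth_pos u = (max 0 u)\<^sup>2 / (1 + max 0 u)"

definition smooth_pos' :: "real \<Rightarrow> real" where
  "smooth_pos' u = 1 - 1 / (1 + max 0 u)\<^sup>2"

lemma smooth_pos_nonneg: "0 \<le> smooth_pos u"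
  by (simp add: smooth_pos_def)

lemma smooth_pos_eq_0: "u \<le> 0 \<Longrightarrow> smooth_pos u = 0"
  by (simp add: smooth_pos_def)

lemma smooth_pos_le: "smooth_pos u \<le> max 0 u"
  by (auto simp: smooth_pos_def max_def power2_eq_square divide_simps algebra_simps)

lemma smooth_pos_ge: "u - 1 \<le> smooth_pos u"
  by (auto simp: smooth_pos_def max_def power2_eq_square divide_simps algebra_simps)

lemma smooth_pos'_mono: "u \<le> v \<Longrightarrow> smooth_pos' u \<le> smooth_pos' v"
  by (auto simp: smooth_pos'_def intro!: divide_left_mono power_mono mult_pos_pos)

lemma smooth_pos'_strict_mono: "0 \<le> u \<Longrightarrow> u < v \<Longrightarrow> smooth_pos' u < smooth_pos' v"
  by (auto simp: smooth_pos'_def intro!: divide_strict_left_mono power_strict_mono mult_pos_pos)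

lemma smooth_pos'_nonneg: "0 \<le> smooth_pos' u"
  by (auto simp: smooth_pos'_def divide_simps)

lemma continuous_on_smooth_pos' [continuous_intros]:
  "continuous_on S f \<Longrightarrow> continuous_on S (\<lambda>x. smooth_pos' (f x))"
  unfolding smooth_pos'_def
  by (intro continuous_intros) (auto simp: max_def add_nonneg_eq_0_iff)

text \<open>Away from 0 one of two smooth formulas holds on an open half-line; at 0 the difference
  quotient is squeezed by \<open>\<bar>y\<bar>\<close>.\<close>

lemma DERIV_smooth_pos: "(smooth_pos has_real_derivative smooth_pos' u) (at u)"
proof -
  consider "u < 0" | "u = 0" | "u > 0" by linarith
  then show ?thesis
  proof cases
    case 1
    have "((\<lambda>u. 0) has_real_derivative 0) (at u)" by simp
    then have "(smooth_pos has_real_derivative 0) (at u)"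
      by (rule has_field_derivative_transform_within_open[where S = "{..<0}"])
        (use 1 in \<open>auto simp: smooth_pos_def\<close>)
    with 1 show ?thesis by (simp add: smooth_pos'_def)
  next
    case 2
    have "((\<lambda>y. smooth_pos y / y) \<longlongrightarrow> 0) (at 0)"
    proof (rule Lim_null_comparison)
      have "norm (smooth_pos y / y) \<le> \<bar>y\<bar>" for y
        by (auto simp: smooth_pos_def max_def power2_eq_square divide_simps)
      then show "eventually (\<lambda>y. norm (smooth_pos y / y) \<le> \<bar>y\<bar>) (at 0)" by simp
      show "((\<lambda>y::real. \<bar>y\<bar>) \<longlongrightarrow> 0) (at 0)" by (rule tendsto_eq_intros | simp)+
    qed
    with 2 show ?thesis by (simp add: has_field_derivative_iff smooth_pos'_def smooth_pos_def)
  next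
    case 3
    have "((\<lambda>u. u\<^sup>2 / (1 + u)) has_real_derivative smooth_pos' u) (at u)"
      using 3 by (auto intro!: derivative_eq_intros
          simp: smooth_pos'_def divide_simps power2_eq_square) (simp add: algebra_simps)
    then show ?thesis
      by (rule has_field_derivative_transform_within_open[where S = "{0<..}"])
        (use 3 in \<open>auto simp: smooth_pos_def\<close>)
  qed
qed

lemma smooth_pos_mono: "u \<le> v \<Longrightarrow> smooth_pos u \<le> smooth_pos v"
  by (rule DERIV_nonneg_imp_nondecreasing) (use DERIV_smooth_pos smooth_pos'_nonneg in blast)+

section \<open>Strict convexity from a strictly increasing derivative\<close>

text \<open>The mean value theorem on either side of the intermediate point \<open>z\<close> yields
  two chord slopes, which are values of \<open>f'\<close> at strictly ordered points.\<close>

lemma strictly_convex_on_if_deriv_strict_mono: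
  fixes f f' :: "real \<Rightarrow> real"
  assumes S: "convex S" and deriv: "\<And>x. x \<in> S \<Longrightarrow> (f has_real_derivative f' x) (at x)"
    and mono: "strict_mono_on S f'"
  shows "strictly_convex_on S f"
proof -
  have *: "f ((1 - t) * x + t * y) < (1 - t) * f x + t * f y"
    if xy: "x \<in> S" "y \<in> S" "x < y" and t: "0 < t" "t < 1" for x y t
  proof -
    define z where "z = (1 - t) * x + t * y"
    have zx: "z - x = t * (y - x)" and yz: "y - z = (1 - t) * (y - x)"
      by (auto simp: z_def algebra_simps)
    have z: "x < z" "z < y" using zx yz xy t by (smt (verit) mult_pos_pos)+
    have S': "w \<in> S" if "x \<le> w" "w \<le> y" for w
      using S that xy by (meson is_interval_convex_1 mem_is_interval_1_I)
    obtain \<xi> where \<xi>: "x < \<xi>" "\<xi> < z" "f z - f x = (z - x) * f' \<xi>"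
      using MVT2[of x z f f'] z deriv S' by force
    obtain \<eta> where \<eta>: "z < \<eta>" "\<eta> < y" "f y - f z = (y - z) * f' \<eta>"
      using MVT2[of z y f f'] z deriv S' by force
    have "f' \<xi> < f' \<eta>"
      using \<xi> \<eta> z S' by (intro strict_mono_onD[OF mono]) auto
    \<comment> \<open>The factor is chosen to be both \<open>(1 - t) * (z - x)\<close> and
      \<open>t * (y - z)\<close>, so slopes become increments.\<close>
    then have "t * ((1 - t) * (y - x)) * f' \<xi> < t * ((1 - t) * (y - x)) * f' \<eta>"
      using t xy by (intro mult_strict_left_mono) auto
    then have "(1 - t) * (f z - f x) < t * (f y - f z)"
      unfolding \<xi> \<eta> zx yz by (simp add: algebra_simps)
    then show ?thesis unfolding z_def[symmetric] by (simp add: algebra_simps)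
  qed
  show ?thesis
    unfolding strictly_convex_on_def
  proof (intro conjI ballI allI impI S)
    fix x y t :: real assume "x \<in> S" "y \<in> S" "x \<noteq> y" "0 < t" "t < 1"
    then show "f ((1 - t) * x + t * y) < (1 - t) * f x + t * f y"
      \<comment> \<open>Swapping the endpoints replaces \<open>t\<close> by
        \<open>1 - t\<close>.\<close>
      using *[of x y t] *[of y x "1 - t"] by (cases "x < y") (auto simp: algebra_simps)
  qed
qed

section \<open>The locally finite sum of shifted smoothings\<close>

locale levels =
  fixes a :: "nat \<Rightarrow> real"
  assumes a_0: "a 0 = 0" and a_ge: "real n \<le> a n"
begin

definition \<Psi> :: "real \<Rightarrow> real" where
  "\<Psi> x = (\<Sum>n. smooth_pos (x - a n))"

definition \<Psi>' :: "real \<Rightarrow> real" where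
  "\<Psi>' x = (\<Sum>n. smooth_pos' (x - a n))"

lemma diff_a_nonpos: "x \<le> real K \<Longrightarrow> n \<notin> {..<K} \<Longrightarrow> x - a n \<le> 0"
  using a_ge[of n] by (simp add: not_less)

lemma smooth_pos_sums: "x \<le> real K \<Longrightarrow> (\<lambda>n. smooth_pos (x - a n)) sums (\<Sum>n<K. smooth_pos (x - a n))"
  by (intro sums_finite) (use diff_a_nonpos smooth_pos_eq_0 in auto)

lemma summable_smooth_pos: "summable (\<lambda>n. smooth_pos (x - a n))"
  using smooth_pos_sums[OF real_nat_ceiling_ge] by (rule sums_summable)

text \<open>Since \<open>a n \<ge> n\<close>, summands from index \<open>K\<close> on vanish up to
  \<open>real K\<close>; local questions about \<open>\<Psi>\<close> thus concern finite
  sums.\<close>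

lemma \<Psi>_eq: "x \<le> real K \<Longrightarrow> \<Psi> x = (\<Sum>n<K. smooth_pos (x - a n))"
  unfolding \<Psi>_def using smooth_pos_sums sums_unique by metis

lemma \<Psi>'_eq: "x \<le> real K \<Longrightarrow> \<Psi>' x = (\<Sum>n<K. smooth_pos' (x - a n))"
  unfolding \<Psi>'_def using diff_a_nonpos[of x K]
  by (intro suminf_finite) (auto simp: smooth_pos'_def)

lemma \<Psi>_nonneg: "0 \<le> \<Psi> x"
  unfolding \<Psi>_def by (intro suminf_nonneg summable_smooth_pos smooth_pos_nonneg)

lemma \<Psi>_0: "\<Psi> 0 = 0"
  using \<Psi>_eq[of 0 0] by simp

lemma \<Psi>_mono: "x \<le> y \<Longrightarrow> \<Psi> x \<le> \<Psi> y"
  unfolding \<Psi>_def by (intro suminf_le summable_smooth_pos smooth_pos_mono) auto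

text \<open>The first \<open>2 * N\<close> summands give at least \<open>2 * (N * s) - C\<close>.
  Half of the linear growth absorbs the constant \<open>C\<close>, the other half exceeds
  \<open>Z * s\<close>.\<close>

lemma \<Psi>_superlinear: "filterlim (\<lambda>s. \<Psi> s / s) at_top at_top"
  \<comment> \<open>Taking \<open>Z \<ge> 1\<close> forces \<open>N \<ge> 1\<close>, hence
    \<open>C \<le> s \<le> N * s\<close> below.\<close>
  unfolding filterlim_at_top_ge[where c = 1]
proof (intro allI impI)
  fix Z :: real assume "1 \<le> Z"
  define N where "N = nat \<lceil>Z\<rceil>"
  have N: "Z \<le> real N" by (simp add: N_def real_nat_ceiling_ge)
  define C where "C = (\<Sum>n<2*N. a n + 1)"
  have "eventually (\<lambda>s. s \<ge> max 1 C) at_top" by (rule eventually_ge_at_top)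
  then show "eventually (\<lambda>s. Z \<le> \<Psi> s / s) at_top"
  proof eventually_elim
    case (elim s)
    have "Z * s \<le> N * s" using elim N by (intro mult_right_mono) auto
    moreover have "s \<le> N * s" using elim N \<open>1 \<le> Z\<close> by (intro mult_le_cancel_right1[THEN iffD2]) auto
    ultimately have "Z * s \<le> 2 * (N * s) - C" using elim by linarith
    also have "\<dots> = (\<Sum>n<2*N. s - a n - 1)"
      by (simp add: C_def sum_subtractf sum.distrib algebra_simps)
    also have "\<dots> \<le> (\<Sum>n<2*N. smooth_pos (s - a n))"
      by (intro sum_mono smooth_pos_ge)
    also have "\<dots> \<le> \<Psi> s"
      unfolding \<Psi>_def by (intro sum_le_suminf summable_smooth_pos) (auto simp: smooth_pos_nonneg)
    finally show ?case using elim by (simp add: field_simps)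
  qed
qed

lemma DERIV_\<Psi>: "(\<Psi> has_real_derivative \<Psi>' x) (at x)"
proof -
  \<comment> \<open>The shift by 1 makes \<open>x < real K\<close> strict, so
    \<open>{..<real K}\<close> is an open neighbourhood of \<open>x\<close> on which
    \<open>\<Psi>\<close> is a finite sum.\<close>
  define K where "K = nat \<lceil>x + 1\<rceil>"
  have K: "x < real K" unfolding K_def using real_nat_ceiling_ge[of "x + 1"] by linarith
  have "((\<lambda>x. \<Sum>n<K. smooth_pos (x - a n)) has_real_derivative (\<Sum>n<K. smooth_pos' (x - a n) * 1)) (at x)"
    by (intro DERIV_sum DERIV_chain2[OF DERIV_smooth_pos]) (auto intro!: derivative_eq_intros)
  then have "((\<lambda>x. \<Sum>n<K. smooth_pos (x - a n)) has_real_derivative \<Psi>' x) (at x)"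
    using K by (simp add: \<Psi>'_eq[of x K])
  then show ?thesis
    by (rule has_field_derivative_transform_within_open[where S = "{..<real K}"])
      (use K in \<open>auto simp: \<Psi>_eq[of _ K]\<close>)
qed

lemma isCont_\<Psi>': "isCont \<Psi>' x"
proof -
  define K where "K = nat \<lceil>x + 1\<rceil>"
  have K: "x < real K" unfolding K_def using real_nat_ceiling_ge[of "x + 1"] by linarith
  have "continuous_on {..<real K} (\<lambda>x. \<Sum>n<K. smooth_pos' (x - a n))"
    by (intro continuous_intros)
  then have "continuous_on {..<real K} \<Psi>'"
    by (rule continuous_on_cong[THEN iffD1, rotated -1]) (auto simp: \<Psi>'_eq[of _ K])
  with K show ?thesis by (simp add: continuous_on_eq_continuous_at)
qed

lemma \<Psi>'_strict_mono: "strict_mono_on {0..} \<Psi>'"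
proof (rule strict_mono_onI)
  fix x y :: real assume xy: "x \<in> {0..}" "y \<in> {0..}" "x < y"
  define K where "K = nat \<lceil>y\<rceil>"
  have K: "y \<le> real K" by (simp add: K_def real_nat_ceiling_ge)
  have "0 < K" using K xy by (cases K) auto
  \<comment> \<open>the summand with \<open>a 0 = 0\<close> is the one that is strictly convex on all of \<open>{0..}\<close>\<close>
  have "(\<Sum>n<K. smooth_pos' (x - a n)) < (\<Sum>n<K. smooth_pos' (y - a n))"
    using xy \<open>0 < K\<close> smooth_pos'_strict_mono[of x y]
    by (intro sum_strict_mono_ex1) (auto intro!: smooth_pos'_mono bexI[of _ 0] simp: a_0)
  with K xy show "\<Psi>' x < \<Psi>' y" by (simp add: \<Psi>'_eq[of _ K])
qed

section \<open>Integral bounds for the constructed function\<close>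

text \<open>The summand with index \<open>n\<close> vanishes unless
  \<open>vabs V \<omega> > a n\<close> and never exceeds \<open>vabs V \<omega>\<close>, so with the
  cutoff at \<open>t\<close> its integral is part of a tail at the larger of the two levels.\<close>

lemma nn_integral_\<Psi>_le:
  assumes V: "random_vector M V" "V \<in> H"
  shows "(\<integral>\<^sup>+\<omega>\<in>{\<omega> \<in> space M. vabs V \<omega> > t}. ennreal (\<Psi> (vabs V \<omega>)) \<partial>M)
    \<le> (\<Sum>n. tail M H (max (a n) t))"
proof -
  from V have [measurable]: "vabs V \<in> borel_measurable M" by (simp add: vabs_measurable)
  have [measurable]: "smooth_pos \<in> borel_measurable borel"
    by (rule borel_measurable_mono) (simp add: mono_def smooth_pos_mono)
  have "(\<integral>\<^sup>+\<omega>\<in>{\<omega> \<in> space M. vabs V \<omega> > t}. ennreal (\<Psi> (vabs V \<omega>)) \<partial>M)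
      = (\<integral>\<^sup>+\<omega>. (\<Sum>n. ennreal (smooth_pos (vabs V \<omega> - a n)) *
            indicator {\<omega> \<in> space M. vabs V \<omega> > t} \<omega>) \<partial>M)"
    by (intro nn_integral_cong)
      (simp add: \<Psi>_def ennreal_suminf_multc suminf_ennreal2 summable_smooth_pos smooth_pos_nonneg)
  also have "\<dots> = (\<Sum>n. \<integral>\<^sup>+\<omega>\<in>{\<omega> \<in> space M. vabs V \<omega> > t}. ennreal (smooth_pos (vabs V \<omega> - a n)) \<partial>M)"
    by (rule nn_integral_suminf) measurable
  also have "\<dots> \<le> (\<Sum>n. tail M H (max (a n) t))"
  proof (intro suminf_le summableI)
    fix n
    have "(\<integral>\<^sup>+\<omega>\<in>{\<omega> \<in> space M. vabs V \<omega> > t}. ennreal (smooth_pos (vabs V \<omega> - a n)) \<partial>M)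
        \<le> (\<integral>\<^sup>+\<omega>\<in>{\<omega> \<in> space M. vabs V \<omega> > max (a n) t}. ennreal (vabs V \<omega>) \<partial>M)"
    proof (intro nn_integral_mono)
      fix \<omega>
      have "0 \<le> a n" using a_ge[of n] by linarith
      then have "smooth_pos (vabs V \<omega> - a n) \<le> vabs V \<omega>"
        using smooth_pos_le[of "vabs V \<omega> - a n"] vabs_nonneg[of V \<omega>] by linarith
      then show "ennreal (smooth_pos (vabs V \<omega> - a n)) * indicator {\<omega> \<in> space M. vabs V \<omega> > t} \<omega>
          \<le> ennreal (vabs V \<omega>) * indicator {\<omega> \<in> space M. vabs V \<omega> > max (a n) t} \<omega>"
        by (cases "a n < vabs V \<omega>") (auto simp: indicator_def smooth_pos_eq_0 intro!: ennreal_leI)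
    qed
    also have "\<dots> \<le> tail M H (max (a n) t)" by (rule tail_upper[OF V(2)])
    finally show "(\<integral>\<^sup>+\<omega>\<in>{\<omega> \<in> space M. vabs V \<omega> > t}. ennreal (smooth_pos (vabs V \<omega> - a n)) \<partial>M)
        \<le> tail M H (max (a n) t)" .
  qed
  finally show ?thesis .
qed

lemma vallee_poussin_\<Psi>:
  assumes V: "\<forall>V\<in>H. random_vector M V" and fin: "(\<Sum>n. tail M H (a n)) < \<infinity>"
  shows "vallee_poussin M H \<Psi>"
proof -
  have "(\<Squnion>V\<in>H. \<integral>\<^sup>+\<omega>. ennreal (\<Psi> (vabs V \<omega>)) \<partial>M) \<le> (\<Sum>n. tail M H (a n))"
  proof (rule SUP_least)
    fix V assume "V \<in> H"
    \<comment> \<open>A negative cutoff excludes no point, and it disappears from the maximum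
      because \<open>a n \<ge> 0\<close>.\<close>
    have "-1 < vabs V \<omega>" for \<omega> using vabs_nonneg[of V \<omega>] by linarith
    then have "(\<integral>\<^sup>+\<omega>. ennreal (\<Psi> (vabs V \<omega>)) \<partial>M)
        = (\<integral>\<^sup>+\<omega>\<in>{\<omega> \<in> space M. vabs V \<omega> > -1}. ennreal (\<Psi> (vabs V \<omega>)) \<partial>M)"
      by (intro nn_integral_cong) (simp add: indicator_def)
    also have "\<dots> \<le> (\<Sum>n. tail M H (max (a n) (-1)))"
      using V \<open>V \<in> H\<close> by (intro nn_integral_\<Psi>_le) auto
    also have "\<dots> = (\<Sum>n. tail M H (a n))"
    proof -
      have "max (a n) (-1) = a n" for n using a_ge[of n] by linarith
      then show ?thesis by simp
    qed
    finally show "(\<integral>\<^sup>+\<omega>. ennreal (\<Psi> (vabs V \<omega>)) \<partial>M) \<le> (\<Sum>n. tail M H (a n))" .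
  qed
  also note fin
  finally show ?thesis
    by (auto simp: vallee_poussin_def \<Psi>_nonneg \<Psi>_0 \<Psi>_superlinear mono_on_def \<Psi>_mono)
qed

text \<open>The bounding series tends to 0 as \<open>t\<close> grows: its remainder after
  \<open>N\<close> terms is small uniformly in \<open>t\<close>, and a large \<open>t\<close> makes
  the first \<open>N\<close> terms small.\<close>

lemma unif_integrable_\<Psi>:
  assumes V: "\<forall>V\<in>H. random_vector M V" and H: "unif_integrable M H"
    and fin: "(\<Sum>n. tail M H (a n)) < \<infinity>"
  shows "unif_integrable M ((\<lambda>V. of_rv (\<lambda>\<omega>. \<Psi> (vabs V \<omega>))) ` H)"
  unfolding unif_integrable_iff_tail
proof (intro allI impI)
  fix e :: real assume "e > 0"
  define g where "g n = tail M H (a n)" for n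
  have "(\<lambda>N. \<Sum>n. g (n + N)) \<longlonglongrightarrow> 0"
  proof -
    \<comment> \<open>All terms are finite, so vanishing of the remainders can be taken from real
      summable series.\<close>
    define c where "c n = enn2real (g n)" for n
    have c: "g n = ennreal (c n)" "0 \<le> c n" for n
      using fin ennreal_suminf_lessD[of g \<top> n] by (simp_all add: c_def g_def)
    have "(\<Sum>n. ennreal (c n)) \<noteq> \<top>"
      using fin unfolding c(1)[symmetric] g_def by simp
    with c(2) have "summable c" by (rule summable_suminf_not_top)
    then have "(\<lambda>N. ennreal (\<Sum>n. c (n + N))) \<longlonglongrightarrow> ennreal 0"
      by (intro tendsto_ennrealI suminf_exist_split2)
    moreover have "(\<Sum>n. g (n + N)) = ennreal (\<Sum>n. c (n + N))" for N
      unfolding c(1) using c(2) \<open>summable c\<close>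
      by (intro suminf_ennreal2) (auto simp: summable_iff_shift)
    ultimately show ?thesis by simp
  qed
  then have "eventually (\<lambda>N. (\<Sum>n. g (n + N)) < ennreal (e / 2)) sequentially"
    using \<open>e > 0\<close> by (intro order_tendstoD) auto
  then obtain N where N: "(\<Sum>n. g (n + N)) < ennreal (e / 2)"
    by (auto simp: eventually_sequentially)
  \<comment> \<open>\<open>N\<close> terms of size \<open>d\<close> add up to at most
    \<open>e / 2\<close>; the 1 covers \<open>N = 0\<close>.\<close>
  define d where "d = e / (2 * (real N + 1))"
  have "d > 0" using \<open>e > 0\<close> by (simp add: d_def)
  with H obtain t where t: "tail M H t \<le> ennreal d"
    unfolding unif_integrable_iff_tail by blast
  have "real N * d \<le> e / 2" using \<open>e > 0\<close> by (simp add: d_def field_simps)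
  have bound: "(\<Sum>n. tail M H (max (a n) t)) \<le> ennreal e"
  proof -
    have "(\<Sum>n. tail M H (max (a n) t))
        = (\<Sum>n<N. tail M H (max (a n) t)) + (\<Sum>n. tail M H (max (a (n + N)) t))"
      by (subst suminf_offset[of _ N]) (auto simp: add.commute)
    also have "\<dots> \<le> (\<Sum>n<N. ennreal d) + (\<Sum>n. g (n + N))"
      unfolding g_def
      by (intro add_mono sum_mono suminf_le summableI tail_antimono order_trans[OF tail_antimono t]) auto
    also have "(\<Sum>n<N. ennreal d) = ennreal (real N * d)"
      using \<open>d > 0\<close> by (simp add: ennreal_mult ennreal_of_nat_eq_real_of_nat)
    also have "ennreal (real N * d) + (\<Sum>n. g (n + N)) \<le> ennreal (e / 2) + ennreal (e / 2)"
      using N \<open>real N * d \<le> e / 2\<close> by (intro add_mono ennreal_leI) auto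
    also have "\<dots> = ennreal e" using \<open>e > 0\<close> by (simp flip: ennreal_plus)
    finally show ?thesis .
  qed
  show "\<exists>s0. \<forall>s\<ge>s0. tail M ((\<lambda>V. of_rv (\<lambda>\<omega>. \<Psi> (vabs V \<omega>))) ` H) s \<le> ennreal e"
  \<comment> \<open>By monotonicity, values of \<open>\<Psi>\<close> above \<open>\<Psi> t\<close>
    occur only at arguments above \<open>t\<close>.\<close>
  proof (intro exI[of _ "\<Psi> t"] allI impI)
    fix s assume s: "s \<ge> \<Psi> t"
    have t_less: "t < x" if "s < \<Psi> x" for x
      using that s \<Psi>_mono[of x t] by (cases "t < x") auto
    show "tail M ((\<lambda>V. of_rv (\<lambda>\<omega>. \<Psi> (vabs V \<omega>))) ` H) s \<le> ennreal e"
      unfolding tail_def image_image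
    proof (rule SUP_least, unfold vabs_of_rv abs_of_nonneg[OF \<Psi>_nonneg])
      fix V assume "V \<in> H"
      have "(\<integral>\<^sup>+\<omega>\<in>{\<omega> \<in> space M. \<Psi> (vabs V \<omega>) > s}. ennreal (\<Psi> (vabs V \<omega>)) \<partial>M)
          \<le> (\<integral>\<^sup>+\<omega>\<in>{\<omega> \<in> space M. vabs V \<omega> > t}. ennreal (\<Psi> (vabs V \<omega>)) \<partial>M)"
        by (intro nn_integral_mono) (auto simp: indicator_def dest: t_less)
      also have "\<dots> \<le> (\<Sum>n. tail M H (max (a n) t))"
        using V \<open>V \<in> H\<close> by (intro nn_integral_\<Psi>_le) auto
      also note bound
      finally show "(\<integral>\<^sup>+\<omega>\<in>{\<omega> \<in> space M. \<Psi> (vabs V \<omega>) > s}. ennreal (\<Psi> (vabs V \<omega>)) \<partial>M) \<le> ennreal e" .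
    qed
  qed
qed

end

section \<open>Choice of the levels and conclusion\<close>

lemma unif_integrable_levels:
  assumes "prob_space M" and "\<forall>V\<in>H. random_vector M V" and H: "unif_integrable M H"
  obtains a where "levels a" and "(\<Sum>n. tail M H (a n)) < \<infinity>"
proof -
  have "\<exists>s. real n \<le> s \<and> tail M H s \<le> ennreal ((1/2)^n)" for n
  proof -
    have "(1/2::real)^n > 0" by simp
    with H obtain s0 where "\<forall>s\<ge>s0. tail M H s \<le> ennreal ((1/2)^n)"
      unfolding unif_integrable_iff_tail by blast
    then show ?thesis by (intro exI[of _ "max s0 (real n)"]) auto
  qed
  then obtain b where b: "\<And>n. real n \<le> b n" "\<And>n. tail M H (b n) \<le> ennreal ((1/2)^n)"
    by metis
  \<comment> \<open>Resetting level 0 loses the bound 1 on that tail, but it is still finite; the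
    other terms are dominated by a geometric series.\<close>
  define a where "a n = (if n = 0 then 0 else b n)" for n
  show ?thesis
  proof
    show "levels a" using b by (auto simp: levels_def a_def)
    have "(\<Sum>n. tail M H (a n)) = tail M H 0 + (\<Sum>n. tail M H (a (Suc n)))"
      by (subst suminf_offset[of _ 1]) (auto simp: a_def)
    also have "(\<Sum>n. tail M H (a (Suc n))) \<le> (\<Sum>n. ennreal ((1/2)^Suc n))"
      using b(2) by (intro suminf_le summableI) (auto simp: a_def simp del: power_Suc)
    also have "\<dots> = ennreal (\<Sum>n. (1/2)^Suc n)"
      by (rule suminf_ennreal2) (auto intro: summable_geometric simp: summable_mult)
    finally have "(\<Sum>n. tail M H (a n)) \<le> tail M H 0 + ennreal (\<Sum>n. (1/2)^Suc n)"
      by (simp add: add_left_mono)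
    also have "\<dots> < \<infinity>" using unif_integrable_tail_0_finite[OF assms] by simp
    finally show "(\<Sum>n. tail M H (a n)) < \<infinity>" .
  qed
qed

theorem corollary2p5:
  fixes M :: "'a measure" and H :: "'a rvec set"
  assumes "prob_space M"
    and "\<forall>V\<in>H. random_vector M V"
  shows "(unif_integrable M H \<longleftrightarrow> (\<exists>\<psi>. vallee_poussin M H \<psi>)) \<and>
    ((\<exists>\<psi>. vallee_poussin M H \<psi>) \<longrightarrow>
      (\<exists>\<psi>. vallee_poussin M H \<psi> \<and> cont_diff_nonneg \<psi> \<and> strictly_convex_on {0..} \<psi> \<and>
        unif_integrable M ((\<lambda>V. of_rv (\<lambda>\<omega>. \<psi> (vabs V \<omega>))) ` H)))"
proof -
  have "\<exists>\<psi>. vallee_poussin M H \<psi> \<and> cont_diff_nonneg \<psi> \<and> strictly_convex_on {0..} \<psi> \<and>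
      unif_integrable M ((\<lambda>V. of_rv (\<lambda>\<omega>. \<psi> (vabs V \<omega>))) ` H)"
    if H: "unif_integrable M H"
  proof -
    obtain a where a: "levels a" and fin: "(\<Sum>n. tail M H (a n)) < \<infinity>"
      using unif_integrable_levels[OF assms H] .
    interpret levels a by (fact a)
    \<comment> \<open>\<open>\<Psi>\<close> is differentiable on the whole line, so the one-sided
      derivative at 0 comes by restriction.\<close>
    have "cont_diff_nonneg \<Psi>"
      unfolding cont_diff_nonneg_def
      by (intro exI[of _ \<Psi>'])
        (auto intro: has_field_derivative_at_within DERIV_\<Psi> continuous_at_imp_continuous_on isCont_\<Psi>')
    moreover have "strictly_convex_on {0..} \<Psi>"
      by (rule strictly_convex_on_if_deriv_strict_mono[OF _ DERIV_\<Psi> \<Psi>'_strict_mono]) simp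
    ultimately show ?thesis
      using vallee_poussin_\<Psi>[OF assms(2) fin] unif_integrable_\<Psi>[OF assms(2) H fin] by blast
  qed
  \<comment> \<open>An arbitrary \<open>\<psi>\<close> is replaced by a regular one by passing
    through uniform integrability.\<close>
  then show ?thesis using vallee_poussin_imp_unif_integrable[OF assms(2)] by blast
qed

end
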